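(* Let $p$ be a prime number. There exists a countable $p$-local group $G$ with a proper invariant metric $d$ such that, for the metric space $(G,d)$, the asymptotic Assouad–Nagata dimension $\mathrm{AN\text{-}asdim}\,G$ differs from the asymptotic dimension with linear control $\ell\text{-}\mathrm{asdim}_*\,G$.
   Context: A group $G$ is $p$-local if every finitely generated subgroup $H\subset G$ is a $p$-torsion group (every element of $H$ has order a power of $p$). A metric on a space is proper if every closed ball is compact. A metric $d$ on a group is invariant if it is invariant under translations by group elements. Let $(X,d)$ be a metric space. For subsets $U,V\subset X$ put $d(U,V)=\inf\{d(u,v)\mid u\in U, v\in V\}$. A family of subsets of $X$ is $\lambda$-disjoint if $d(U,V)>\lambda$ for any two distinct members $U,V$; it is $D$-uniformly bounded if $\mathrm{diam}(U)\le D$ for every member $U$. For $\lambda>0$, $D\ge 0$ and an integer $n\ge 0$, write $(\lambda,D)\text{-}\dim X\le n$ if there are $n+1$ families $\mathcal U^0,\dots,\mathcal U^n$ of subsets of $X$, each $\lambda$-disjoint and $D$-uniformly bounded, such that $\mathcal U^0\cup\dots\cup\mathcal U^n$ covers $X$. $\ell\text{-}\mathrm{asdim}_*X\le n$ means: there is $c>0$ such that for every $R<\infty$ there is $\lambda>R$ with $(\lambda,c\lambda)\text{-}\dim X\le n$. $\mathrm{AN\text{-}asdim}\,X\le n$ means: there are $c>0$ and $r_0$ such that $(\lambda,c\lambda)\text{-}\dim X\le n$ for all $\lambda>r_0$. Each of these dimensions is the smallest integer $n\ge 0$ for which the corresponding condition holds, and $\infty$ if there is none. *)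

theory Defs
  imports
    "HOL-Analysis.Abstract_Metric_Spaces"
    "HOL-Library.Extended_Nat"
    "HOL-Library.Extended_Real"
    "HOL-Library.Countable_Set"
    "HOL-Computational_Algebra.Primes"
    "HOL-Algebra.Generated_Groups"
    "HOL-Algebra.Multiplicative_Group"
begin

text \<open>An element of infinite order has \<open>ord\<close> equal to 0, which is not a power of a prime.\<close>

definition p_torsion_group :: "nat \<Rightarrow> ('a, 'b) monoid_scheme \<Rightarrow> bool" where
  "p_torsion_group p H \<longleftrightarrow> group H \<and> (\<forall>x\<in>carrier H. \<exists>k::nat. group.ord H x = p ^ k)"

definition p_local :: "nat \<Rightarrow> ('a, 'b) monoid_scheme \<Rightarrow> bool" where
  "p_local p G \<longleftrightarrow>
     (\<forall>S. finite S \<and> S \<subseteq> carrier G \<longrightarrow> p_torsion_group p (G\<lparr>carrier := generate G S\<rparr>))"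

definition proper_metric_on :: "'a set \<Rightarrow> ('a \<Rightarrow> 'a \<Rightarrow> real) \<Rightarrow> bool" where
  "proper_metric_on X d \<longleftrightarrow>
     Metric_space X d \<and>
     (\<forall>x\<in>X. \<forall>r. compactin (Metric_space.mtopology X d) (Metric_space.mcball X d x r))"

text \<open>Invariance under all translations, left and right.\<close>

definition invariant_metric :: "('a, 'b) monoid_scheme \<Rightarrow> ('a \<Rightarrow> 'a \<Rightarrow> real) \<Rightarrow> bool" where
  "invariant_metric G d \<longleftrightarrow>
     (\<forall>g\<in>carrier G. \<forall>x\<in>carrier G. \<forall>y\<in>carrier G.
        d (g \<otimes>\<^bsub>G\<^esub> x) (g \<otimes>\<^bsub>G\<^esub> y) = d x y \<and>
        d (x \<otimes>\<^bsub>G\<^esub> g) (y \<otimes>\<^bsub>G\<^esub> g) = d x y)"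

text \<open>Infima and suprema are taken in the extended reals: the empty set is at distance \<open>\<infinity>\<close> from
  every set, it has diameter \<open>-\<infinity>\<close>, and an unbounded set has diameter \<open>\<infinity>\<close>.\<close>

definition set_distance :: "('a \<Rightarrow> 'a \<Rightarrow> real) \<Rightarrow> 'a set \<Rightarrow> 'a set \<Rightarrow> ereal" where
  "set_distance d U V = (INF u\<in>U. INF v\<in>V. ereal (d u v))"

definition set_diameter :: "('a \<Rightarrow> 'a \<Rightarrow> real) \<Rightarrow> 'a set \<Rightarrow> ereal" where
  "set_diameter d U = (SUP u\<in>U. SUP v\<in>U. ereal (d u v))"

definition disjoint_family_at :: "('a \<Rightarrow> 'a \<Rightarrow> real) \<Rightarrow> real \<Rightarrow> 'a set set \<Rightarrow> bool" where
  "disjoint_family_at d l \<U> \<longleftrightarrow>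
     (\<forall>U\<in>\<U>. \<forall>V\<in>\<U>. U \<noteq> V \<longrightarrow> set_distance d U V > ereal l)"

definition uniformly_bounded_family :: "('a \<Rightarrow> 'a \<Rightarrow> real) \<Rightarrow> real \<Rightarrow> 'a set set \<Rightarrow> bool" where
  "uniformly_bounded_family d D \<U> \<longleftrightarrow> (\<forall>U\<in>\<U>. set_diameter d U \<le> ereal D)"

text \<open>\<open>(l, D)\<close>-dim \<open>X \<le> n\<close>, for \<open>l > 0\<close> and \<open>D \<ge> 0\<close>\<close>

definition scale_dim_le :: "'a set \<Rightarrow> ('a \<Rightarrow> 'a \<Rightarrow> real) \<Rightarrow> real \<Rightarrow> real \<Rightarrow> nat \<Rightarrow> bool" where
  "scale_dim_le X d l D n \<longleftrightarrow>
     (\<exists>\<U> :: nat \<Rightarrow> 'a set set.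
        (\<forall>i\<le>n. (\<forall>U\<in>\<U> i. U \<subseteq> X) \<and>
                disjoint_family_at d l (\<U> i) \<and>
                uniformly_bounded_family d D (\<U> i)) \<and>
        X \<subseteq> (\<Union>i\<le>n. \<Union>(\<U> i)))"

definition l_asdim_star_le :: "'a set \<Rightarrow> ('a \<Rightarrow> 'a \<Rightarrow> real) \<Rightarrow> nat \<Rightarrow> bool" where
  "l_asdim_star_le X d n \<longleftrightarrow>
     (\<exists>c>0. \<forall>R::real. \<exists>l>R. l > 0 \<and> scale_dim_le X d l (c * l) n)"

definition AN_asdim_le :: "'a set \<Rightarrow> ('a \<Rightarrow> 'a \<Rightarrow> real) \<Rightarrow> nat \<Rightarrow> bool" where
  "AN_asdim_le X d n \<longleftrightarrow>
     (\<exists>c>0. \<exists>r0::real. \<forall>l>r0. l > 0 \<longrightarrow> scale_dim_le X d l (c * l) n)"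

text \<open>In \<open>enat\<close>, the infimum of a nonempty set is its least element and \<open>Inf {} = \<infinity>\<close>.\<close>

definition l_asdim_star :: "'a set \<Rightarrow> ('a \<Rightarrow> 'a \<Rightarrow> real) \<Rightarrow> enat" where
  "l_asdim_star X d = Inf {enat n |n. l_asdim_star_le X d n}"

definition AN_asdim :: "'a set \<Rightarrow> ('a \<Rightarrow> 'a \<Rightarrow> real) \<Rightarrow> enat" where
  "AN_asdim X d = Inf {enat n |n. AN_asdim_le X d n}"

end

theory Submission
  imports Defs "HOL-Number_Theory.Cong"
begin

text \<open>
  The example is an elementary abelian group, a countable direct sum of copies of
  \<open>\<int>/p\<close>, with a weighted Hamming metric. The coordinates come in blocks: block \<open>i\<close> has \<open>i\<close>
  coordinates, all of weight \<open>i!\<close>, and the distance of two elements is the total weight of the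
  coordinates where they differ. Every element satisfies \<open>x\<^sup>p = 1\<close>, so the group is \<open>p\<close>-local.
  Translations move the two elements without changing the set of
  these coordinates, so the metric is invariant. It is proper because the weights tend to infinity.

  The two dimensions are separated at \<open>n = 0\<close>. There the cover is a single \<open>\<lambda>\<close>-disjoint family,
  and it has to keep together any two points joined by a chain of steps of length at most \<open>\<lambda>\<close>.

  At the scale \<open>\<lambda> = i!\<close>, one can change the coordinates of block \<open>i\<close> one after the other. Such a
  chain joins points at distance \<open>i \<cdot> i!\<close>, and \<open>i \<cdot> i! / \<lambda> = i\<close> is unbounded. This excludes
  dimension 0 with linear control at all large scales (\<open>not_AN_asdim_le_0\<close>).

  At the scale \<open>\<lambda> = (i+1)! - 1\<close>, no step can change a coordinate of a block beyond \<open>i\<close>. The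
  members of the cover are therefore the cosets of the subgroup of the blocks up to \<open>i\<close>, and the
  diameter of that subgroup is \<open>\<Sum>k\<le>i. k \<cdot> k! = (i+1)! - 1 = \<lambda>\<close>. So dimension 0 is attained
  with constant 1 at arbitrarily large scales (\<open>l_asdim_star_le_0\<close>).
\<close>

section \<open>Groups of prime exponent\<close>

text \<open>The order of an element divides the exponent \<open>p\<close>, so it is \<open>p\<^sup>0\<close> or \<open>p\<^sup>1\<close>. Orders have to be taken
  in the generated subgroup, whose powers agree with those of \<open>G\<close>.\<close>

lemma p_local_of_prime_exponent:
  fixes G (structure)
  assumes "prime p" "group G" and exponent: "\<And>x. x \<in> carrier G \<Longrightarrow> x [^] p = \<one>"
  shows "p_local p G"
  unfolding p_local_def p_torsion_group_def
proof (intro allI impI conjI ballI)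
  interpret group G by fact
  fix S assume "finite S \<and> S \<subseteq> carrier G"
  then have sub: "subgroup (generate G S) G" by (simp add: generate_is_subgroup)
  show grp: "group (G\<lparr>carrier := generate G S\<rparr>)"
    using sub by (rule subgroup_imp_group)
  fix x assume "x \<in> carrier (G\<lparr>carrier := generate G S\<rparr>)"
  then have x: "x \<in> generate G S" by simp
  then have "x [^]\<^bsub>G\<lparr>carrier := generate G S\<rparr>\<^esub> p = \<one>\<^bsub>G\<lparr>carrier := generate G S\<rparr>\<^esub>"
    using exponent[of x] subgroup.mem_carrier[OF sub] by (simp flip: nat_pow_consistent)
  then have "group.ord (G\<lparr>carrier := generate G S\<rparr>) x dvd p"
    using group.pow_eq_id[OF grp, of x p] x by simp
  with \<open>prime p\<close> show "\<exists>k. group.ord (G\<lparr>carrier := generate G S\<rparr>) x = p ^ k"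
    by (metis power_0 power_one_right prime_nat_iff)
qed

section \<open>The set of elements\<close>

definition block_indices :: "nat \<Rightarrow> (nat \<times> nat) set" where
  "block_indices n = (SIGMA i:{..<n}. {..<i})"

definition elements_upto :: "nat \<Rightarrow> nat \<Rightarrow> (nat \<times> nat \<Rightarrow> nat) set" where
  "elements_upto p n = {f. \<forall>j. (j \<in> block_indices n \<longrightarrow> f j \<in> {..<p}) \<and> (j \<notin> block_indices n \<longrightarrow> f j = 0)}"

text \<open>The coordinate with index \<open>(i, k)\<close> is the \<open>k\<close>th coordinate of block \<open>i\<close>, where \<open>k < i\<close>. The
  values at the other indices are fixed to 0.\<close>

definition elements :: "nat \<Rightarrow> (nat \<times> nat \<Rightarrow> nat) set" where
  "elements p = (\<Union>n. elements_upto p n)"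

lemma finite_block_indices [simp]: "finite (block_indices n)"
  by (simp add: block_indices_def)

lemma mem_block_indices [simp]: "(i, k) \<in> block_indices n \<longleftrightarrow> i < n \<and> k < i"
  by (auto simp: block_indices_def)

lemma block_indices_mono: "m \<le> n \<Longrightarrow> block_indices m \<subseteq> block_indices n"
  by (auto simp: block_indices_def)

lemma finite_elements_upto: "finite (elements_upto p n)"
  unfolding elements_upto_def by (rule finite_set_of_finite_funs) simp_all

lemma elements_uptoI:
  assumes "\<And>j. f j < p" "\<And>j. f j \<noteq> 0 \<Longrightarrow> j \<in> block_indices n"
  shows "f \<in> elements_upto p n"
  unfolding elements_upto_def using assms by blast

lemma elements_uptoD:
  assumes "f \<in> elements_upto p n"
  shows "if j \<in> block_indices n then f j < p else f j = 0"
  using spec[OF assms[unfolded elements_upto_def mem_Collect_eq], of j] by simp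

lemma elements_upto_less: "f \<in> elements_upto p n \<Longrightarrow> 0 < p \<Longrightarrow> f j < p"
  using elements_uptoD[of f p n j] by (simp split: if_splits)

lemma elements_upto_support: "f \<in> elements_upto p n \<Longrightarrow> f j \<noteq> 0 \<Longrightarrow> j \<in> block_indices n"
  using elements_uptoD[of f p n j] by (simp split: if_splits)

lemma elements_upto_mono:
  assumes "0 < p" "m \<le> n"
  shows "elements_upto p m \<subseteq> elements_upto p n"
proof
  fix f assume f: "f \<in> elements_upto p m"
  show "f \<in> elements_upto p n"
  proof (rule elements_uptoI)
    show "f j < p" for j using f assms(1) by (rule elements_upto_less)
    show "j \<in> block_indices n" if "f j \<noteq> 0" for j
      using elements_upto_support[OF f that] block_indices_mono[OF assms(2)] by (rule set_rev_mp)
  qed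
qed

lemma elements_upto_subset: "elements_upto p n \<subseteq> elements p"
  by (auto simp: elements_def)

lemma elements_less: "f \<in> elements p \<Longrightarrow> 0 < p \<Longrightarrow> f j < p"
  by (auto simp: elements_def intro: elements_upto_less)

lemma elements_support: "f \<in> elements p \<Longrightarrow> f j \<noteq> 0 \<Longrightarrow> snd j < fst j"
  by (cases j) (auto simp: elements_def dest: elements_upto_support)

lemma elements_common_bound:
  assumes "0 < p" "f \<in> elements p" "g \<in> elements p"
  obtains n where "f \<in> elements_upto p n" "g \<in> elements_upto p n"
proof -
  obtain m n where "f \<in> elements_upto p m" "g \<in> elements_upto p n"
    using assms by (auto simp: elements_def)
  with elements_upto_mono[OF \<open>0 < p\<close>, of m "max m n"] elements_upto_mono[OF \<open>0 < p\<close>, of n "max m n"]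
  show ?thesis by (intro that[of "max m n"]) auto
qed

lemma countable_elements: "countable (elements p)"
  unfolding elements_def by (intro countable_UN) (auto intro: countable_finite finite_elements_upto)

lemma infinite_elements:
  assumes "2 \<le> p" shows "infinite (elements p)"
proof -
  define e where "e i = (\<lambda>j. if j = (Suc i, 0::nat) then 1 else 0 :: nat)" for i :: nat
  have "e i \<in> elements_upto p (Suc (Suc i))" for i
    using assms by (intro elements_uptoI) (auto simp: e_def split: if_splits)
  then have "e i \<in> elements p" for i
    using elements_upto_subset by blast
  moreover have "inj e"
    by (auto simp: inj_on_def e_def fun_eq_iff split: if_splits)
  ultimately show ?thesis
    using infinite_UNIV_nat by (metis finite_subset image_subsetI finite_imageD)
qed

section \<open>The group\<close>

definition digitwise_add :: "nat \<Rightarrow> ('i \<Rightarrow> nat) \<Rightarrow> ('i \<Rightarrow> nat) \<Rightarrow> 'i \<Rightarrow> nat" where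
  "digitwise_add p f g = (\<lambda>j. (f j + g j) mod p)"

text \<open>Since the set of elements is countably infinite, its enumeration transports the group
  structure to all natural numbers.\<close>

definition dec :: "nat \<Rightarrow> nat \<Rightarrow> nat \<times> nat \<Rightarrow> nat" where
  "dec p = from_nat_into (elements p)"

definition enc :: "nat \<Rightarrow> (nat \<times> nat \<Rightarrow> nat) \<Rightarrow> nat" where
  "enc p = to_nat_on (elements p)"

definition block_group :: "nat \<Rightarrow> nat monoid" where
  "block_group p = \<lparr>carrier = UNIV,
     mult = (\<lambda>x y. enc p (digitwise_add p (dec p x) (dec p y))),
     one = enc p (\<lambda>_. 0)\<rparr>"

lemma carrier_block_group [simp]: "carrier (block_group p) = UNIV"
  by (simp add: block_group_def)

lemma dec_in_elements: "2 \<le> p \<Longrightarrow> dec p x \<in> elements p"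
  unfolding dec_def by (metis from_nat_into infinite_elements infinite_imp_nonempty)

lemma dec_enc: "f \<in> elements p \<Longrightarrow> dec p (enc p f) = f"
  unfolding dec_def enc_def by (simp add: countable_elements)

lemma dec_less: "2 \<le> p \<Longrightarrow> dec p x j < p"
  using elements_less[OF dec_in_elements] by simp

lemma inj_dec: "2 \<le> p \<Longrightarrow> inj (dec p)"
  unfolding dec_def
  using bij_betw_from_nat_into[OF countable_elements infinite_elements] bij_betw_imp_inj_on by blast

lemma zero_in_elements: "0 < p \<Longrightarrow> (\<lambda>_. 0) \<in> elements p"
  by (rule subsetD[OF elements_upto_subset[of p 0]], rule elements_uptoI) auto

lemma pointwise_in_elements:
  assumes "2 \<le> p" "f \<in> elements p" "g \<in> elements p"
    "\<And>j. h j < p" "\<And>j. f j = 0 \<Longrightarrow> g j = 0 \<Longrightarrow> h j = 0"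
  shows "h \<in> elements p"
proof -
  obtain n where n: "f \<in> elements_upto p n" "g \<in> elements_upto p n"
    by (rule elements_common_bound[OF _ assms(2,3)]) (use assms(1) in simp)
  have "h \<in> elements_upto p n"
  proof (rule elements_uptoI)
    fix j assume "h j \<noteq> 0"
    then have "f j \<noteq> 0 \<or> g j \<noteq> 0" using assms(5)[of j] by auto
    then show "j \<in> block_indices n"
      using elements_upto_support[OF n(1)] elements_upto_support[OF n(2)] by (elim disjE)
  qed (rule assms(4))
  then show ?thesis using elements_upto_subset by (rule subsetD[rotated])
qed

lemma dec_mult:
  assumes "2 \<le> p"
  shows "dec p (x \<otimes>\<^bsub>block_group p\<^esub> y) = digitwise_add p (dec p x) (dec p y)"
proof -
  have "digitwise_add p (dec p x) (dec p y) \<in> elements p"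
    using assms
    by (intro pointwise_in_elements[OF assms dec_in_elements[of p x] dec_in_elements[of p y]])
      (auto simp: digitwise_add_def)
  then show ?thesis by (simp add: block_group_def dec_enc)
qed

lemma dec_one: "2 \<le> p \<Longrightarrow> dec p \<one>\<^bsub>block_group p\<^esub> = (\<lambda>_. 0)"
  by (simp add: block_group_def dec_enc zero_in_elements)

lemma group_block_group:
  assumes "2 \<le> p"
  shows "group (block_group p)"
proof (rule groupI)
  fix x y z
  show "x \<otimes>\<^bsub>block_group p\<^esub> y \<otimes>\<^bsub>block_group p\<^esub> z = x \<otimes>\<^bsub>block_group p\<^esub> (y \<otimes>\<^bsub>block_group p\<^esub> z)"
    by (rule injD[OF inj_dec[OF assms]])
      (simp add: dec_mult assms digitwise_add_def mod_simps add.assoc)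
  show "\<one>\<^bsub>block_group p\<^esub> \<otimes>\<^bsub>block_group p\<^esub> x = x"
    by (rule injD[OF inj_dec[OF assms]])
      (simp add: dec_mult dec_one assms digitwise_add_def dec_less)
  define h where "h = (\<lambda>j. (p - dec p x j) mod p)"
  have h: "h \<in> elements p"
    using assms
    by (intro pointwise_in_elements[OF assms dec_in_elements[of p x] dec_in_elements[of p x]])
      (auto simp: h_def)
  have "enc p h \<otimes>\<^bsub>block_group p\<^esub> x = \<one>\<^bsub>block_group p\<^esub>"
  proof (rule injD[OF inj_dec[OF assms]])
    have "(h j + dec p x j) mod p = 0" for j
      using dec_less[OF assms, of x j] by (simp add: h_def mod_simps)
    then show "dec p (enc p h \<otimes>\<^bsub>block_group p\<^esub> x) = dec p \<one>\<^bsub>block_group p\<^esub>"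
      by (simp add: dec_mult dec_one dec_enc h assms digitwise_add_def)
  qed
  then show "\<exists>y\<in>carrier (block_group p). y \<otimes>\<^bsub>block_group p\<^esub> x = \<one>\<^bsub>block_group p\<^esub>"
    by auto
qed simp_all

lemma dec_pow:
  assumes "2 \<le> p"
  shows "dec p (x [^]\<^bsub>block_group p\<^esub> (n::nat)) j = (n * dec p x j) mod p"
proof (induction n)
  case 0
  then show ?case by (simp add: dec_one assms)
next
  case (Suc n)
  have "dec p (x [^]\<^bsub>block_group p\<^esub> Suc n) j = ((n * dec p x j) mod p + dec p x j) mod p"
    by (simp only: nat_pow_Suc dec_mult[OF assms] digitwise_add_def Suc.IH)
  also have "\<dots> = (n * dec p x j + dec p x j) mod p" by (rule mod_add_left_eq)
  finally show ?case by (simp only: mult_Suc add.commute)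
qed

lemma p_local_block_group:
  assumes "prime p"
  shows "p_local p (block_group p)"
proof (rule p_local_of_prime_exponent[OF assms])
  have p: "2 \<le> p" using assms by (rule prime_ge_2_nat)
  show "group (block_group p)" using p by (rule group_block_group)
  fix x
  show "x [^]\<^bsub>block_group p\<^esub> p = \<one>\<^bsub>block_group p\<^esub>"
    by (rule injD[OF inj_dec[OF p]]) (simp add: fun_eq_iff dec_pow dec_one p)
qed

section \<open>The metric\<close>

definition hamming :: "(nat \<times> nat \<Rightarrow> nat) \<Rightarrow> (nat \<times> nat \<Rightarrow> nat) \<Rightarrow> real" where
  "hamming f g = (\<Sum>j | f j \<noteq> g j. fact (fst j))"

definition block_dist :: "nat \<Rightarrow> nat \<Rightarrow> nat \<Rightarrow> real" where
  "block_dist p x y = hamming (dec p x) (dec p y)"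

lemma finite_differences:
  assumes "0 < p" "f \<in> elements p" "g \<in> elements p"
  shows "finite {j. f j \<noteq> g j}"
proof -
  obtain n where n: "f \<in> elements_upto p n" "g \<in> elements_upto p n"
    using assms by (rule elements_common_bound)
  have "{j. f j \<noteq> g j} \<subseteq> block_indices n"
  proof
    fix j assume "j \<in> {j. f j \<noteq> g j}"
    then have "f j \<noteq> 0 \<or> g j \<noteq> 0" by (cases "f j = 0") auto
    then show "j \<in> block_indices n"
      using elements_upto_support[OF n(1)] elements_upto_support[OF n(2)] by (elim disjE)
  qed
  then show ?thesis by (rule finite_subset) simp
qed

lemma finite_dec_differences: "2 \<le> p \<Longrightarrow> finite {j. dec p x j \<noteq> dec p y j}"
  using finite_differences[OF _ dec_in_elements dec_in_elements] by simp

lemma fact_le_block_dist: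
  assumes "2 \<le> p" "dec p x j \<noteq> dec p y j"
  shows "fact (fst j) \<le> block_dist p x y"
  unfolding block_dist_def hamming_def
  using assms by (intro member_le_sum finite_dec_differences) auto

lemma block_dist_commute: "block_dist p x y = block_dist p y x"
  unfolding block_dist_def hamming_def by (intro sum.cong) auto

lemma Metric_space_block_dist:
  assumes "2 \<le> p"
  shows "Metric_space UNIV (block_dist p)"
proof
  fix x y z
  show "0 \<le> block_dist p x y"
    unfolding block_dist_def hamming_def by (rule sum_nonneg) simp
  show "block_dist p x y = block_dist p y x" by (rule block_dist_commute)
  show "block_dist p x y = 0 \<longleftrightarrow> x = y"
  proof
    assume zero: "block_dist p x y = 0"
    have "dec p x j = dec p y j" for j
    proof (rule ccontr)
      assume "dec p x j \<noteq> dec p y j"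
      from fact_le_block_dist[OF assms this] zero
      have "(fact (fst j) :: real) \<le> 0" by simp
      then show False using fact_gt_zero[of "fst j", where ?'a = real] by linarith
    qed
    then have "dec p x = dec p y" by (rule ext)
    then show "x = y" by (rule injD[OF inj_dec[OF assms]])
  qed (simp add: block_dist_def hamming_def)
  let ?D = "\<lambda>x y. {j. dec p x j \<noteq> dec p y j}"
  have "block_dist p x z \<le> (\<Sum>j\<in>?D x y \<union> ?D y z. fact (fst j))"
    unfolding block_dist_def hamming_def
    using assms by (intro sum_mono2) (auto intro: finite_dec_differences)
  also have "\<dots> \<le> (\<Sum>j\<in>?D x y. fact (fst j)) + (\<Sum>j\<in>?D y z. fact (fst j))"
    using assms by (simp add: sum_Un finite_dec_differences sum_nonneg)
  finally show "block_dist p x z \<le> block_dist p x y + block_dist p y z"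
    by (simp add: block_dist_def hamming_def)
qed

text \<open>If \<open>y\<close> lies in the ball of radius \<open>r\<close> around \<open>x\<close>, then \<open>y\<close> agrees with \<open>x\<close> in every block
  \<open>i\<close> with \<open>i! > r\<close>, hence in every block \<open>i > r\<close>. This leaves finitely many possibilities for \<open>y\<close>.\<close>

lemma finite_ball:
  assumes "2 \<le> p"
  shows "finite {y. block_dist p x y \<le> r}"
proof -
  obtain n where n: "dec p x \<in> elements_upto p n"
    using dec_in_elements[OF assms, of x] by (auto simp: elements_def)
  let ?m = "max n (Suc (nat \<lfloor>r\<rfloor>))"
  have "dec p y \<in> elements_upto p ?m" if "block_dist p x y \<le> r" for y
  proof (rule elements_uptoI)
    show "dec p y j < p" for j by (rule dec_less[OF assms])
    fix j assume nonzero: "dec p y j \<noteq> 0"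
    show "j \<in> block_indices ?m"
    proof (cases "dec p x j = dec p y j")
      case True
      with n nonzero have "j \<in> block_indices n" by (simp add: elements_upto_support)
      then show ?thesis using block_indices_mono[of n ?m] by auto
    next
      case False
      have "real (fst j) \<le> real (fact (fst j))" by (simp only: of_nat_le_iff fact_ge_self)
      also have "\<dots> \<le> r" using fact_le_block_dist[OF assms False] that by simp
      finally have "fst j \<le> nat \<lfloor>r\<rfloor>" by (simp add: le_nat_floor)
      moreover from nonzero have "snd j < fst j"
        using elements_support[OF dec_in_elements[OF assms]] by simp
      ultimately show ?thesis by (cases j) auto
    qed
  qed
  then have "{y. block_dist p x y \<le> r} \<subseteq> dec p -` elements_upto p ?m" by auto
  then show ?thesis
    using finite_vimageI[OF finite_elements_upto inj_dec[OF assms]] by (rule finite_subset)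
qed

lemma proper_block_dist:
  assumes "2 \<le> p"
  shows "proper_metric_on UNIV (block_dist p)"
proof -
  interpret Metric_space UNIV "block_dist p" using assms by (rule Metric_space_block_dist)
  have "compactin mtopology (mcball x r)" for x r
    using finite_ball[OF assms, of x r] by (intro finite_imp_compactin) (auto simp: mcball_def)
  then show ?thesis
    unfolding proper_metric_on_def by (intro conjI ballI allI Metric_space_axioms)
qed

lemma add_mod_cancel:
  fixes a b c :: nat
  assumes "a < p" "b < p"
  shows "(c + a) mod p = (c + b) mod p \<longleftrightarrow> a = b"
  using assms cong_add_lcancel_nat[of c a b p] by (simp add: cong_def)

lemma invariant_block_dist:
  assumes "2 \<le> p"
  shows "invariant_metric (block_group p) (block_dist p)"
  using assms add_mod_cancel[OF dec_less dec_less, OF assms assms]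
  unfolding invariant_metric_def block_dist_def hamming_def
  by (simp add: dec_mult digitwise_add_def add.commute)

section \<open>Linear control at some scales\<close>

text \<open>This is the diameter of the subgroup of the blocks up to \<open>n\<close>. The weights and block sizes are
  chosen so that the sum \<open>\<Sum>i\<le>n. i \<cdot> i!\<close> telescopes to a number just below the weight of the next
  block.\<close>

lemma sum_block_indices_fact:
  "(\<Sum>j\<in>block_indices (Suc n). fact (fst j)) = (fact (Suc n) - 1 :: real)"
proof -
  have "(\<Sum>j\<in>block_indices (Suc n). fact (fst j)) = (\<Sum>i<Suc n. real i * fact i)"
    using sum.Sigma[of "{..<Suc n}" lessThan "\<lambda>i k. fact i :: real"]
    by (simp add: block_indices_def split_beta)
  also have "\<dots> = fact (Suc n) - 1"
    by (induction n) (simp_all add: algebra_simps)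
  finally show ?thesis .
qed

text \<open>The cosets of the subgroup of the blocks up to \<open>n\<close> form the cover. Elements of different cosets
  differ in a coordinate of a later block, whose weight is at least \<open>(n+1)!\<close>.\<close>

lemma scale_dim_le_0_below_fact:
  assumes "2 \<le> p"
  shows "scale_dim_le UNIV (block_dist p) (fact (Suc n) - 1) (fact (Suc n) - 1) 0"
proof -
  let ?l = "fact (Suc n) - 1 :: real"
  \<comment> \<open>the coset of \<open>x\<close> for the subgroup of the blocks up to \<open>n\<close>\<close>
  define C where "C x = {y. \<forall>j. n < fst j \<longrightarrow> dec p y j = dec p x j}" for x
  have C_I: "y \<in> C x" if "\<And>j. n < fst j \<Longrightarrow> dec p y j = dec p x j" for x y
    using that unfolding C_def by (intro CollectI allI impI)
  have C_D: "dec p y j = dec p x j" if "y \<in> C x" "n < fst j" for x y j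
    using that(1)[unfolded C_def, THEN CollectD, THEN spec, of j] that(2) by (rule mp)
  have C_eq: "C y = C x" if "y \<in> C x" for x y
  proof (intro equalityI subsetI C_I)
    fix z and j :: "nat \<times> nat" assume "z \<in> C y" "n < fst j"
    then show "dec p z j = dec p x j" by (simp only: C_D[of z y] C_D[OF \<open>y \<in> C x\<close>])
  next
    fix z and j :: "nat \<times> nat" assume "z \<in> C x" "n < fst j"
    then show "dec p z j = dec p y j" by (simp only: C_D[of z x] C_D[OF \<open>y \<in> C x\<close>])
  qed
  have disjoint: "set_distance (block_dist p) (C x) (C y) > ereal ?l" if "C x \<noteq> C y" for x y
  proof -
    have "fact (Suc n) \<le> block_dist p u v" if "u \<in> C x" "v \<in> C y" for u v
    proof -
      have "u \<notin> C v" using that \<open>C x \<noteq> C y\<close> by (metis C_eq)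
      then obtain j where "dec p u j \<noteq> dec p v j" "n < fst j" using C_I[of u v] by metis
      then have "(fact (Suc n) :: real) \<le> fact (fst j)" by (intro fact_mono) auto
      also have "\<dots> \<le> block_dist p u v" by (rule fact_le_block_dist) fact+
      finally show ?thesis .
    qed
    then have "ereal (fact (Suc n)) \<le> set_distance (block_dist p) (C x) (C y)"
      unfolding set_distance_def by (intro INF_greatest) (simp del: fact_Suc)
    then show ?thesis by (rule less_le_trans[rotated]) simp
  qed
  have bounded: "set_diameter (block_dist p) (C x) \<le> ereal ?l" for x
  proof -
    have "block_dist p u v \<le> ?l" if "u \<in> C x" "v \<in> C x" for u v
    proof -
      have "{j. dec p u j \<noteq> dec p v j} \<subseteq> block_indices (Suc n)"
      proof
        fix j assume "j \<in> {j. dec p u j \<noteq> dec p v j}"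
        then have differ: "dec p u j \<noteq> dec p v j" by simp
        with C_D[OF that(1), of j] C_D[OF that(2), of j] have "fst j \<le> n" by (cases "n < fst j") simp_all
        moreover have "snd j < fst j"
        proof -
          from differ have "dec p u j \<noteq> 0 \<or> dec p v j \<noteq> 0" by (cases "dec p u j = 0") simp_all
          then show ?thesis
            by (elim disjE) (rule elements_support[OF dec_in_elements[OF assms]], assumption)+
        qed
        ultimately show "j \<in> block_indices (Suc n)" by (cases j) auto
      qed
      then have "block_dist p u v \<le> (\<Sum>j\<in>block_indices (Suc n). fact (fst j))"
        unfolding block_dist_def hamming_def by (intro sum_mono2) auto
      then show ?thesis by (simp only: sum_block_indices_fact)
    qed
    then show ?thesis
      unfolding set_diameter_def by (intro SUP_least) (simp del: fact_Suc)
  qed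
  have "x \<in> C x" for x by (rule C_I) (rule refl)
  then have "UNIV \<subseteq> \<Union>(range C)" by blast
  moreover have "disjoint_family_at (block_dist p) ?l (range C)"
    unfolding disjoint_family_at_def using disjoint by blast
  moreover have "uniformly_bounded_family (block_dist p) ?l (range C)"
    unfolding uniformly_bounded_family_def using bounded by blast
  ultimately show ?thesis
    unfolding scale_dim_le_def by (intro exI[of _ "\<lambda>_. range C"]) (simp del: fact_Suc)
qed

lemma l_asdim_star_le_0:
  assumes "2 \<le> p"
  shows "l_asdim_star_le UNIV (block_dist p) 0"
  unfolding l_asdim_star_le_def
proof (rule exI[of _ 1], intro conjI allI)
  fix R :: real
  \<comment> \<open>large enough that \<open>(n+1)! - 1\<close> exceeds both \<open>R\<close> and 0, since \<open>(n+1)! \<ge> n+1\<close>\<close>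
  define n where "n = nat \<lceil>max R 0\<rceil> + 1"
  have "max R 0 + 1 < real (Suc n)" unfolding n_def by linarith
  also have "\<dots> \<le> real (fact (Suc n))" by (simp only: of_nat_le_iff fact_ge_self)
  finally have "max R 0 < fact (Suc n) - 1" by (simp only: of_nat_fact less_diff_eq)
  then show "\<exists>l>R. 0 < l \<and> scale_dim_le UNIV (block_dist p) l (1 * l) 0"
    using scale_dim_le_0_below_fact[OF assms, of n]
    by (intro exI[of _ "fact (Suc n) - 1"]) (simp del: fact_Suc)
qed simp

section \<open>No linear control at all scales\<close>

lemma set_distance_le: "u \<in> U \<Longrightarrow> v \<in> V \<Longrightarrow> set_distance d U V \<le> ereal (d u v)"
  unfolding set_distance_def by (meson INF_lower2 INF_lower)

lemma le_set_diameter: "u \<in> U \<Longrightarrow> v \<in> U \<Longrightarrow> ereal (d u v) \<le> set_diameter d U"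
  unfolding set_diameter_def by (meson SUP_upper2 SUP_upper)

text \<open>A single \<open>l\<close>-disjoint family cannot separate the end points of a step of length at most \<open>l\<close>, so
  the whole chain stays in the member that contains \<open>x 0\<close>.\<close>

lemma scale_dim_le_0_chain:
  assumes "scale_dim_le X d l D 0" and chain: "\<And>k. k \<le> n \<Longrightarrow> x k \<in> X"
    and steps: "\<And>k. k < n \<Longrightarrow> d (x k) (x (Suc k)) \<le> l"
  shows "d (x 0) (x n) \<le> D"
proof -
  obtain \<U> where disjoint: "disjoint_family_at d l \<U>"
    and bounded: "uniformly_bounded_family d D \<U>" and cover: "X \<subseteq> \<Union>\<U>"
    using assms(1) by (auto simp: scale_dim_le_def)
  obtain U where U: "U \<in> \<U>" "x 0 \<in> U" using chain[of 0] cover by auto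
  have "x k \<in> U" if "k \<le> n" for k
    using that
  proof (induction k)
    case (Suc k)
    obtain V where V: "V \<in> \<U>" "x (Suc k) \<in> V" using chain[of "Suc k"] Suc.prems cover by auto
    have "set_distance d U V \<le> ereal (d (x k) (x (Suc k)))"
      using Suc V by (intro set_distance_le) auto
    also have "\<dots> \<le> ereal l" using steps Suc.prems by simp
    finally have "U = V" using disjoint U V by (auto simp: disjoint_family_at_def not_less[symmetric])
    with V show ?case by simp
  qed (simp add: U)
  then have "ereal (d (x 0) (x n)) \<le> set_diameter d U" using U by (intro le_set_diameter) auto
  also have "\<dots> \<le> ereal D" using bounded U by (auto simp: uniformly_bounded_family_def)
  finally show ?thesis by simp
qed

text \<open>The chain goes from 0 to the element with all coordinates of block \<open>i\<close> equal to 1, one coordinate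
  at a time. Any \<open>i\<close> beyond the constant \<open>c\<close> and the threshold \<open>r0\<close> gives a contradiction at the
  scale \<open>i!\<close>.\<close>

lemma not_AN_asdim_le_0:
  assumes "2 \<le> p"
  shows "\<not> AN_asdim_le UNIV (block_dist p) 0"
proof
  assume "AN_asdim_le UNIV (block_dist p) 0"
  then obtain c r0 :: real where control:
    "\<And>l. l > r0 \<Longrightarrow> l > 0 \<Longrightarrow> scale_dim_le UNIV (block_dist p) l (c * l) 0"
    by (auto simp: AN_asdim_le_def)
  define i where "i = nat \<lceil>max c r0\<rceil> + 1"
  have i: "real i > max c r0" unfolding i_def by linarith
  have "real i \<le> real (fact i)" by (simp only: of_nat_le_iff fact_ge_self)
  with i have scale: "scale_dim_le UNIV (block_dist p) (fact i) (c * fact i) 0"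
    by (intro control) auto
  \<comment> \<open>the element with value 1 in the first \<open>k\<close> coordinates of block \<open>i\<close>\<close>
  define s where "s k = (\<lambda>j. if fst j = i \<and> snd j < k then 1 else 0 :: nat)" for k :: nat
  have "s k \<in> elements_upto p (Suc i)" if "k \<le> i" for k
    using assms that by (intro elements_uptoI) (auto simp: s_def split: if_splits)
  then have s: "s k \<in> elements p" if "k \<le> i" for k
    using that elements_upto_subset by blast
  define x where "x k = enc p (s k)" for k
  have dist: "block_dist p (x k) (x m) = real (m - k) * fact i" if "k \<le> m" "m \<le> i" for k m
  proof -
    have "{j. s k j \<noteq> s m j} = {i} \<times> {k..<m}"
      using that by (auto simp: s_def split: if_splits)
    moreover have "(\<Sum>j\<in>{i} \<times> {k..<m}. fact (fst j)) = real (m - k) * fact i"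
      using sum.cartesian_product[of "\<lambda>i k. fact i :: real" "{k..<m}" "{i}"]
      by (simp add: split_beta)
    ultimately show ?thesis
      using that s[of k] s[of m] by (simp only: block_dist_def hamming_def x_def dec_enc)
  qed
  have "block_dist p (x 0) (x i) \<le> c * fact i"
    by (rule scale_dim_le_0_chain[OF scale]) (simp_all add: dist)
  with dist[of 0 i] have "real i \<le> c" by simp
  with i show False by simp
qed

section \<open>The two dimensions differ\<close>

theorem theorem2p7:
  fixes p :: nat
  assumes "prime p"
  shows "\<exists>(G :: nat monoid) (d :: nat \<Rightarrow> nat \<Rightarrow> real).
           group G \<and> countable (carrier G) \<and> p_local p G \<and>
           proper_metric_on (carrier G) d \<and> invariant_metric G d \<and>
           AN_asdim (carrier G) d \<noteq> l_asdim_star (carrier G) d"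
proof -
  have p: "2 \<le> p" using assms by (rule prime_ge_2_nat)
  have "l_asdim_star UNIV (block_dist p) \<le> enat 0"
    unfolding l_asdim_star_def using l_asdim_star_le_0[OF p] by (intro Inf_lower) blast
  then have l0: "l_asdim_star UNIV (block_dist p) = 0" by (simp flip: zero_enat_def)
  have "1 \<le> AN_asdim UNIV (block_dist p)"
    unfolding AN_asdim_def
  proof (rule Inf_greatest)
    fix a assume "a \<in> {enat n |n. AN_asdim_le UNIV (block_dist p) n}"
    then obtain n where n: "a = enat n" "AN_asdim_le UNIV (block_dist p) n" by auto
    then have "n \<noteq> 0" using not_AN_asdim_le_0[OF p] by (cases n) auto
    with n show "1 \<le> a" by (simp add: one_enat_def)
  qed
  with l0 have "AN_asdim UNIV (block_dist p) \<noteq> l_asdim_star UNIV (block_dist p)" by auto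
  with p assms show ?thesis
    by (intro exI[of _ "block_group p"] exI[of _ "block_dist p"])
      (simp add: group_block_group p_local_block_group proper_block_dist invariant_block_dist)
qed

end
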